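(* Let $d\ge2$ and $n\ge1$, and set $\alpha=(d-2)/2$. For $k\ge1$ let $\tau_k(d)\ge0$ be the smallest possible value (infimum) of $$\sigma_d(\{\mathbf{x}\in\mathbb{S}^d:f(\mathbf{x})>0\})$$ over all harmonic polynomials $f\not\equiv0$ on $\mathbb{R}^{d+1}$ of degree at most $k$ with $f(0)=0$. Then $$\tau_{2n-1}(d)\le\sigma_d\big(\mathcal{C}(x_{n,n})\big)\quad\text{and}\quad\tau_{2n}(d)\le\sigma_d\big(\mathcal{C}(\xi_{n,n})\big),$$ where $x_{n,n}$ is the largest zero of the Jacobi polynomial $P_n^{(\alpha,\alpha)}(x)$ and $\xi_{n,n}$ is the largest zero of the Jacobi polynomial $P_n^{(\alpha,\alpha+1)}(x)$.
   Context: $\sigma_d$ is the normalized surface measure on $\mathbb{S}^d\subset\mathbb{R}^{d+1}$ (total mass $1$), $\mathbf{v}=(0,\dots,0,1)\in\mathbb{S}^d$, and for $-1\le t\le1$, $\mathcal{C}(t)=\{\mathbf{x}\in\mathbb{S}^d:\mathbf{x}\cdot\mathbf{v}\ge t\}$ is the spherical cap centered at $\mathbf{v}$. Polynomials are real-valued. The Jacobi polynomials, for $\alpha,\beta>-1$, are $$P_n^{(\alpha,\beta)}(x)=\frac{(-1)^n}{2^nn!}(1-x)^{-\alpha}(1+x)^{-\beta}\frac{d^n}{dx^n}\left[(1-x)^{n+\alpha}(1+x)^{n+\beta}\right],\quad x\in(-1,1).$$ *)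

theory Defs
  imports "HOL-Probability.Probability" "HOL-Computational_Algebra.Polynomial"
begin

subsection \<open>Normalized surface measure on the unit sphere\<close>

text \<open>
  By polar coordinates, the normalized surface measure is the image of the uniform
  distribution on the unit ball under radial projection \<open>x \<mapsto> x / norm x\<close>, which is \<^const>\<open>sgn\<close>.
  Equivalently, the surface area of \<open>A\<close> is proportional to the volume of the cone over \<open>A\<close>; see
  \<open>emeasure_sphere_measure\<close>. Lemmas \<open>prob_space_sphere_measure\<close> and \<open>sphere_measure_rotation\<close>
  confirm that the total mass is 1 and that the measure is rotation invariant.
\<close>

definition sphere_measure :: "'a::euclidean_space measure" where
  "sphere_measure =
     restrict_space (distr (uniform_measure lborel (ball 0 1)) borel sgn) (sphere 0 1)"

lemma space_sphere_measure [simp]: "space sphere_measure = sphere 0 1"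
  by (simp add: sphere_measure_def space_restrict_space)

lemma sets_sphere_measure:
  "sets sphere_measure = sets (restrict_space borel (sphere (0::'a::euclidean_space) 1))"
  by (simp add: sphere_measure_def sets_restrict_space)

lemma sets_sphere_measure_iff:
  "A \<in> sets sphere_measure \<longleftrightarrow> A \<in> sets borel \<and> A \<subseteq> sphere (0::'a::euclidean_space) 1"
  by (subst sets_sphere_measure, subst sets_restrict_space_iff) auto

lemma open_cone_eq:
  fixes A :: "'a::real_normed_vector set"
  assumes "A \<subseteq> sphere 0 1"
  shows "{r *\<^sub>R x | r x. 0 < r \<and> r < 1 \<and> x \<in> A} = ball 0 1 \<inter> sgn -` A" (is "?R = ?L")
proof (intro equalityI subsetI)
  fix y assume y: "y \<in> ?L"
  then have "y \<noteq> 0" using assms by auto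
  then have "y = norm y *\<^sub>R sgn y" by (simp add: sgn_div_norm)
  then show "y \<in> ?R" using y \<open>y \<noteq> 0\<close>
    by (intro CollectI exI[of _ "norm y"] exI[of _ "sgn y"]) auto
next
  fix y assume "y \<in> ?R"
  then obtain r x where "0 < r" "r < 1" "x \<in> A" "y = r *\<^sub>R x" by blast
  moreover from this have "norm x = 1" using assms by auto
  ultimately show "y \<in> ?L" by (simp add: sgn_div_norm)
qed

lemma sets_borel_open_cone:
  fixes A :: "'a::euclidean_space set"
  assumes "A \<in> sets sphere_measure"
  shows "{r *\<^sub>R x | r x. 0 < r \<and> r < 1 \<and> x \<in> A} \<in> sets borel"
  using assms measurable_sets[OF borel_measurable_sgn, of A]
  by (subst open_cone_eq) (auto simp: sets_sphere_measure_iff)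

lemma emeasure_sphere_measure:
  fixes A :: "'a::euclidean_space set"
  assumes "A \<in> sets sphere_measure"
  shows "emeasure sphere_measure A =
           emeasure lborel {r *\<^sub>R x | r x. 0 < r \<and> r < 1 \<and> x \<in> A} / emeasure lborel (ball (0::'a) 1)"
proof -
  from assms have A: "A \<in> sets borel" "A \<subseteq> sphere 0 1"
    by (auto simp: sets_sphere_measure_iff)
  have "sgn -` A \<in> sets (borel :: 'a measure)"
    using measurable_sets[OF borel_measurable_sgn A(1)] by simp
  with A show ?thesis
    by (subst open_cone_eq) (simp_all add: sphere_measure_def emeasure_restrict_space emeasure_distr)
qed

lemma prob_space_sphere_measure: "prob_space (sphere_measure :: 'a::euclidean_space measure)"
proof
  let ?B = "ball (0::'a) 1"
  have B: "emeasure lborel ?B \<noteq> 0" "emeasure lborel ?B \<noteq> \<infinity>"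
    using emeasure_lborel_ball_finite[of "0::'a" 1] content_ball_pos[of 1 "0::'a"]
    by (auto simp: measure_def)
  have s: "sgn -` sphere (0::'a) 1 = - {0}"
    by (auto simp: norm_sgn)
  have "emeasure lborel (?B \<inter> - {0}) = emeasure lborel ?B"
    using emeasure_Diff_null_set[of "{0::'a}" lborel ?B]
    by (simp add: Diff_eq null_sets_def)
  then show "emeasure (sphere_measure :: 'a measure) (space sphere_measure) = 1"
    using B by (simp add: sphere_measure_def space_restrict_space emeasure_restrict_space
        emeasure_distr s ennreal_divide_self less_top)
qed

lemma sphere_measure_rotation:
  fixes T :: "real^'n::{finite,wellorder} \<Rightarrow> real^'n::_" and A :: "(real^'n::_) set"
  assumes T: "orthogonal_transformation T" and A: "A \<in> sets sphere_measure"
  shows "emeasure sphere_measure (T ` A) = emeasure sphere_measure A"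
proof -
  let ?C = "\<lambda>A :: (real^'n::_) set. {r *\<^sub>R x | r x. 0 < r \<and> r < 1 \<and> x \<in> A}"
  have lin: "linear T" and inj: "inj T" and nrm: "norm (T x) = norm x" for x
    using T by (auto simp: orthogonal_transformation_linear orthogonal_transformation_inj
        orthogonal_transformation_norm)
  have bnd: "?C B \<subseteq> ball 0 1" if "B \<in> sets sphere_measure" for B
    using that by (fastforce simp: sets_sphere_measure_iff)
  have TA: "T ` A \<in> sets sphere_measure"
  proof -
    obtain S where S: "linear S" "S \<circ> T = id" "T \<circ> S = id"
      using linear_injective_isomorphism[OF lin inj] by (auto simp: fun_eq_iff)
    then have "T ` A = S -` A" by (auto simp: fun_eq_iff image_iff) metis
    moreover have "S -` A \<in> sets borel"
      using measurable_sets[OF borel_measurable_continuous_onI[OF linear_continuous_on], of S A]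
        S(1) A by (auto simp: sets_sphere_measure_iff linear_conv_bounded_linear)
    moreover have "T ` A \<subseteq> sphere 0 1" using A by (auto simp: sets_sphere_measure_iff nrm)
    ultimately show ?thesis by (simp add: sets_sphere_measure_iff)
  qed
  have img: "?C (T ` A) = T ` ?C A"
  proof (intro equalityI subsetI)
    fix y assume "y \<in> ?C (T ` A)"
    then obtain r x where "0 < r" "r < 1" "x \<in> A" "y = r *\<^sub>R T x" by blast
    then show "y \<in> T ` ?C A"
      by (intro image_eqI[of _ _ "r *\<^sub>R x"]) (auto simp: linear_scale[OF lin])
  next
    fix y assume "y \<in> T ` ?C A"
    then obtain r x where "0 < r" "r < 1" "x \<in> A" "y = T (r *\<^sub>R x)" by blast
    then show "y \<in> ?C (T ` A)" by (auto simp: linear_scale[OF lin])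
  qed
  have fin: "emeasure lborel (?C B) \<noteq> \<infinity>" and lm: "?C B \<in> lmeasurable"
    if B: "B \<in> sets sphere_measure" for B
  proof -
    have "emeasure lborel (?C B) \<le> emeasure lborel (ball (0::real^'n::_) 1)"
      using bnd[OF B] by (intro emeasure_mono) auto
    then show f: "emeasure lborel (?C B) \<noteq> \<infinity>"
      using emeasure_lborel_ball_finite[of "0::real^'n::_" 1] by (auto simp: top_unique)
    show "?C B \<in> lmeasurable"
      using f sets_borel_open_cone[OF B] by (intro fmeasurableI) (auto simp: less_top[symmetric])
  qed
  have "measure lborel (?C (T ` A)) = measure lborel (?C A)"
    using measure_orthogonal_image[OF T lm[OF A]] sets_borel_open_cone[OF A] sets_borel_open_cone[OF TA] img
    by (simp add: measure_completion)
  then have "emeasure lborel (?C (T ` A)) = emeasure lborel (?C A)"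
    using fin[OF A] fin[OF TA] by (simp add: emeasure_eq_ennreal_measure)
  then show ?thesis by (simp add: emeasure_sphere_measure A TA)
qed

subsection \<open>Spherical caps about the last coordinate vector\<close>

definition north_pole :: "real^'n::{finite,linorder}" where
  "north_pole = axis (Max UNIV) 1"

definition cap :: "real \<Rightarrow> (real^'n::{finite,linorder}) set" where
  "cap t = {x \<in> sphere 0 1. t \<le> x \<bullet> north_pole}"

subsection \<open>Harmonic polynomials\<close>

definition poly_fun_deg_le :: "nat \<Rightarrow> (real^'n \<Rightarrow> real) \<Rightarrow> bool" where
  "poly_fun_deg_le k f \<longleftrightarrow>
     (\<exists>c :: ('n \<Rightarrow> nat) \<Rightarrow> real.
        \<forall>x. f x = (\<Sum>m | (\<Sum>i\<in>UNIV. m i) \<le> k. c m * (\<Prod>i\<in>UNIV. (x $ i) ^ m i)))"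

text \<open>The sum above is over a finite set, so it never takes the default value 0.\<close>

lemma finite_exponents: "finite {m :: 'n::finite \<Rightarrow> nat. (\<Sum>i\<in>UNIV. m i) \<le> k}"
proof (rule finite_subset)
  show "{m :: 'n \<Rightarrow> nat. (\<Sum>i\<in>UNIV. m i) \<le> k} \<subseteq> Pi\<^sub>E UNIV (\<lambda>_. {..k})"
  proof
    fix m :: "'n \<Rightarrow> nat"
    assume "m \<in> {m. (\<Sum>i\<in>UNIV. m i) \<le> k}"
    then have "m i \<le> k" for i
      using member_le_sum[of i UNIV m] by simp
    then show "m \<in> Pi\<^sub>E UNIV (\<lambda>_. {..k})" by (simp add: PiE_def Pi_def)
  qed
qed (auto intro: finite_PiE)

definition partial_deriv :: "'n \<Rightarrow> (real^'n \<Rightarrow> real) \<Rightarrow> real^'n \<Rightarrow> real" where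
  "partial_deriv i f x = deriv (\<lambda>t. f (x + t *\<^sub>R axis i 1)) 0"

definition laplacian :: "(real^'n \<Rightarrow> real) \<Rightarrow> real^'n \<Rightarrow> real" where
  "laplacian f x = (\<Sum>i\<in>UNIV. partial_deriv i (partial_deriv i f) x)"

definition harmonic_poly :: "nat \<Rightarrow> (real^'n \<Rightarrow> real) \<Rightarrow> bool" where
  "harmonic_poly k f \<longleftrightarrow> poly_fun_deg_le k f \<and> (\<forall>x. laplacian f x = 0)"

text \<open>
  The ambient space \<open>\<real>\<^sup>d\<^sup>+\<^sup>1\<close> is \<open>real^'n\<close>, so the dimension \<open>d = CARD('n) - 1\<close> of the sphere enters
  through the index type. The infimum is a genuine one for \<open>k \<ge> 1\<close>: the set is bounded
  below by 0 and contains the value given by a coordinate function.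
\<close>

definition tau :: "'n::finite itself \<Rightarrow> nat \<Rightarrow> real" where
  "tau _ k = Inf {measure sphere_measure {x \<in> sphere 0 1. f x > 0} | f :: real^'n \<Rightarrow> real.
                    harmonic_poly k f \<and> f \<noteq> (\<lambda>_. 0) \<and> f 0 = 0}"

subsection \<open>Jacobi polynomials\<close>

definition jacobi_rodrigues :: "nat \<Rightarrow> real \<Rightarrow> real \<Rightarrow> real \<Rightarrow> real" where
  "jacobi_rodrigues n \<alpha> \<beta> x =
     (-1) ^ n / (2 ^ n * fact n) * (1 - x) powr (- \<alpha>) * (1 + x) powr (- \<beta>) *
     (deriv ^^ n) (\<lambda>y. (1 - y) powr (real n + \<alpha>) * (1 + y) powr (real n + \<beta>)) x"

text \<open>
  Rodrigues' formula only makes sense on \<open>(-1, 1)\<close>; the Jacobi polynomial is the unique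
  polynomial that agrees with it there (existence and uniqueness: \<open>jacobi_poly_ex1\<close>).
\<close>

definition jacobi_poly :: "nat \<Rightarrow> real \<Rightarrow> real \<Rightarrow> real poly" where
  "jacobi_poly n \<alpha> \<beta> = (THE p. \<forall>x\<in>{-1<..<1}. poly p x = jacobi_rodrigues n \<alpha> \<beta> x)"

lemma jacobi_weight_deriv:
  fixes p :: "real poly" and a b x :: real
  assumes "x \<in> {-1<..<1}"
  shows "((\<lambda>y. (1 - y) powr a * (1 + y) powr b * poly p y) has_real_derivative
           (1 - x) powr (a - 1) * (1 + x) powr (b - 1) *
           poly (smult (-a) ([:1, 1:] * p) + smult b ([:1, -1:] * p) + [:1, 0, -1:] * pderiv p) x)
         (at x)"
proof -
  have pos: "1 - x > 0" "1 + x > 0" using assms by auto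
  have 1: "(1 - x) powr a = (1 - x) * (1 - x) powr (a - 1)"
          "(1 + x) powr b = (1 + x) * (1 + x) powr (b - 1)"
    using pos by (simp_all add: powr_mult_base)
  define u v where "u = (1 - x) powr (a - 1)" and "v = (1 + x) powr (b - 1)"
  have du: "((\<lambda>y. (1 - y) powr a) has_real_derivative - a * u) (at x)"
    using DERIV_fun_powr[of "\<lambda>y. 1 - y" "-1" x a] pos unfolding u_def
    by (auto intro!: derivative_eq_intros)
  have dv: "((\<lambda>y. (1 + y) powr b) has_real_derivative b * v) (at x)"
    using DERIV_fun_powr[of "\<lambda>y. 1 + y" 1 x b] pos unfolding v_def
    by (auto intro!: derivative_eq_intros)
  have "((\<lambda>y. (1 - y) powr a * (1 + y) powr b * poly p y) has_real_derivative
      (- a * u * (1 + x) powr b + b * v * (1 - x) powr a) * poly p x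
      + poly (pderiv p) x * ((1 - x) powr a * (1 + x) powr b)) (at x)"
    by (rule DERIV_mult[OF DERIV_mult[OF du dv] poly_DERIV])
  also have "(- a * u * (1 + x) powr b + b * v * (1 - x) powr a) * poly p x
      + poly (pderiv p) x * ((1 - x) powr a * (1 + x) powr b) =
      u * v * poly (smult (-a) ([:1, 1:] * p) + smult b ([:1, -1:] * p) + [:1, 0, -1:] * pderiv p) x"
    unfolding 1 u_def[symmetric] v_def[symmetric] by (simp add: algebra_simps)
  finally show ?thesis unfolding u_def v_def .
qed

lemma jacobi_weight_deriv_funpow:
  "\<exists>p :: real poly. \<forall>x\<in>{-1<..<1}.
     (deriv ^^ k) (\<lambda>y. (1 - y) powr a * (1 + y) powr b) x =
     (1 - x) powr (a - real k) * (1 + x) powr (b - real k) * poly p x"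
proof (induction k)
  case 0
  show ?case by (intro exI[of _ 1]) simp
next
  case (Suc k)
  let ?f = "(deriv ^^ k) (\<lambda>y::real. (1 - y) powr a * (1 + y) powr b)"
  from Suc obtain p where p: "\<And>x. x \<in> {-1<..<1} \<Longrightarrow>
      ?f x = (1 - x) powr (a - real k) * (1 + x) powr (b - real k) * poly p x" by blast
  let ?q = "smult (-(a - real k)) ([:1, 1:] * p) + smult (b - real k) ([:1, -1:] * p)
            + [:1, 0, -1:] * pderiv p"
  have "deriv ?f x = (1 - x) powr (a - real (Suc k)) * (1 + x) powr (b - real (Suc k)) * poly ?q x"
    if x: "x \<in> {-1<..<1}" for x
  proof (rule DERIV_imp_deriv)
    have "(?f has_real_derivative
        (1 - x) powr (a - real k - 1) * (1 + x) powr (b - real k - 1) * poly ?q x) (at x)"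
      by (rule has_field_derivative_transform_within_open[OF jacobi_weight_deriv[OF x], of "{-1<..<1}"])
         (use x p in auto)
    then show "(?f has_real_derivative
        (1 - x) powr (a - real (Suc k)) * (1 + x) powr (b - real (Suc k)) * poly ?q x) (at x)"
      by (simp add: algebra_simps)
  qed
  then show ?case by (intro exI[of _ ?q]) simp
qed

lemma jacobi_poly_ex1: "\<exists>!p. \<forall>x\<in>{-1<..<1}. poly p x = jacobi_rodrigues n \<alpha> \<beta> x"
proof (rule ex_ex1I)
  obtain p :: "real poly" where p: "\<And>x. x \<in> {-1<..<1} \<Longrightarrow>
     (deriv ^^ n) (\<lambda>y. (1 - y) powr (real n + \<alpha>) * (1 + y) powr (real n + \<beta>)) x =
     (1 - x) powr \<alpha> * (1 + x) powr \<beta> * poly p x"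
    using jacobi_weight_deriv_funpow[of n "real n + \<alpha>" "real n + \<beta>"] by auto
  have "poly (smult ((-1) ^ n / (2 ^ n * fact n)) p) x = jacobi_rodrigues n \<alpha> \<beta> x"
    if x: "x \<in> {-1<..<1}" for x
    unfolding jacobi_rodrigues_def p[OF x] using x by (simp add: powr_minus field_simps)
  then show "\<exists>p. \<forall>x\<in>{-1<..<1}. poly p x = jacobi_rodrigues n \<alpha> \<beta> x" by blast
next
  fix p q :: "real poly"
  assume *: "\<forall>x\<in>{-1<..<1}. poly p x = jacobi_rodrigues n \<alpha> \<beta> x"
            "\<forall>x\<in>{-1<..<1}. poly q x = jacobi_rodrigues n \<alpha> \<beta> x"
  then have "{-1<..<1} \<subseteq> {x. poly (p - q) x = 0}" by auto
  moreover have "infinite {-1<..<1::real}" by (rule infinite_Ioo) simp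
  ultimately have "infinite {x. poly (p - q) x = 0}" using finite_subset by blast
  then show "p = q" using poly_roots_finite[of "p - q"] by auto
qed

definition largest_zero :: "real poly \<Rightarrow> real" where
  "largest_zero p = Max {x. poly p x = 0}"

end

theory Submission
  imports Defs
begin

text \<open>
  Let \<open>P\<close> be the Jacobi polynomial of degree \<open>n\<close> with largest zero \<open>z\<close>. The zonal function with profile
  \<open>p t = (P t)\<^sup>2 / (t - z)\<close> is positive on the sphere only inside the cap \<open>t \<ge> z\<close>, and \<open>p\<close> is a
  polynomial of degree \<open>2 n - 1\<close>. A function on the sphere that is the restriction of a polynomial
  extends to a harmonic polynomial of no larger degree, whose value at \<open>0\<close> is its spherical mean; for
  a zonal function this mean is proportional to the integral of \<open>p\<close> against
  \<open>(1 - t) powr \<alpha> * (1 + t) powr \<alpha>\<close>. For the \<open>p\<close> above it vanishes because \<open>P\<close> is orthogonal to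
  \<open>P / (t - z)\<close>, which has smaller degree. In even degree \<open>2 n\<close> an additional factor
  \<open>1 + t \<ge> 0\<close> is available; it raises the second parameter of the weight by one.
  
  Integration is replaced throughout by algebra. A polynomial \<open>p\<close> has weighted integral \<open>0\<close> when
  \<open>(1 - t) powr (a - 1) * (1 + t) powr (b - 1) * p\<close> is the derivative of
  \<open>(1 - t) powr a * (1 + t) powr b * h\<close> for some polynomial \<open>h\<close>, that is, when \<open>p = wderiv a b h\<close>.
  Rodrigues' formula writes \<open>P\<close> as an iterated \<open>wderiv\<close> of \<open>1\<close> (\<open>jacobi_poly_eq\<close>), and
  integration by parts shows that \<open>P * g\<close> lies in the range of \<open>wderiv\<close> whenever
  \<open>degree g < n\<close> (\<open>rodrigues_poly_mult_in_range\<close>).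
  
  The link to harmonic functions is that, for \<open>a = b = d / 2\<close>, the operator \<open>g \<mapsto> wderiv a b (pderiv g)\<close> is
  the Laplace-Beltrami operator of the sphere acting on zonal functions. Its eigenfunctions are the
  zonal spherical harmonics. If \<open>h = pderiv g\<close> and \<open>g\<close> is expanded in them, then
  \<open>p = wderiv a b h\<close> is a combination of zonal harmonics of positive degree, the constant having
  eigenvalue \<open>0\<close>; all of these extend to homogeneous harmonic polynomials that vanish at the origin
  (\<open>zonal_harmonic_extension\<close>). Thus every nonzero \<open>p\<close> in the range of \<open>wderiv\<close> bounds \<^const>\<open>tau\<close> by
  the measure of any cap that contains its positivity set (\<open>tau_le_measure_cap\<close>).
\<close>

section \<open>Weighted differentiation of polynomials\<close>

text \<open>
  The derivative of \<open>(1 - x) powr a * (1 + x) powr b * q\<close>, divided by the weight with both exponents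
  lowered by one (\<open>jacobi_weight_deriv\<close>).
\<close>

definition wderiv :: "real \<Rightarrow> real \<Rightarrow> real poly \<Rightarrow> real poly" where
  "wderiv a b q = smult (-a) ([:1, 1:] * q) + smult b ([:1, -1:] * q) + [:1, 0, -1:] * pderiv q"

lemma wderiv_mult: "wderiv a b (q * g) = wderiv a b q * g + [:1, 0, -1:] * (q * pderiv g)"
proof (rule poly_ext)
  show "poly (wderiv a b (q * g)) x = poly (wderiv a b q * g + [:1, 0, -1:] * (q * pderiv g)) x" for x
    by (simp add: wderiv_def pderiv_mult algebra_simps)
qed

text \<open>
  Both sides come from differentiating the same product: a factor \<open>1 - x\<^sup>2\<close> of the polynomial may as
  well be counted as part of the weight. The next lemma is the same remark for the factor \<open>1 + x\<close>.
\<close>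

lemma wderiv_shift: "wderiv a b ([:1, 0, -1:] * q) = [:1, 0, -1:] * wderiv (a + 1) (b + 1) q"
proof (rule poly_ext)
  show "poly (wderiv a b ([:1, 0, -1:] * q)) x = poly ([:1, 0, -1:] * wderiv (a + 1) (b + 1) q) x" for x
    unfolding wderiv_def pderiv_mult by (simp add: pderiv_pCons algebra_simps)
qed

lemma wderiv_shift_right: "wderiv a b ([:1, 1:] * q) = [:1, 1:] * wderiv a (b + 1) q"
proof (rule poly_ext)
  show "poly (wderiv a b ([:1, 1:] * q)) x = poly ([:1, 1:] * wderiv a (b + 1) q) x" for x
    unfolding wderiv_def pderiv_mult by (simp add: pderiv_pCons algebra_simps)
qed

lemma wderiv_diff: "wderiv a b (p - q) = wderiv a b p - wderiv a b q"
proof (rule poly_ext)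
  show "poly (wderiv a b (p - q)) x = poly (wderiv a b p - wderiv a b q) x" for x
    by (simp add: wderiv_def pderiv_diff algebra_simps)
qed

lemma wderiv_smult: "wderiv a b (smult c p) = smult c (wderiv a b p)"
proof (rule poly_ext)
  show "poly (wderiv a b (smult c p)) x = poly (smult c (wderiv a b p)) x" for x
    by (simp add: wderiv_def pderiv_smult algebra_simps)
qed

text \<open>
  The leading term shows how \<open>wderiv\<close> moves degrees: it raises the degree of a
  nonzero polynomial by exactly one when \<open>a + b > 0\<close>.
\<close>

lemma coeff_wderiv_top:
  assumes "degree q \<le> m"
  shows "coeff (wderiv a b q) (Suc m) = - (a + b + real m) * coeff q m"
proof -
  have 1: "[:1, 0, -1:] * pderiv q = pderiv q - pCons 0 (pCons 0 (pderiv q))"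
    by simp
  have z: "coeff q (Suc m) = 0" "coeff q (Suc (Suc m)) = 0"
    using assms by (auto intro: coeff_eq_0)
  have "coeff (pCons 0 (pCons 0 (pderiv q))) (Suc m) = real m * coeff q m"
    by (cases m) (simp_all add: coeff_pderiv)
  with z show ?thesis
    unfolding wderiv_def 1 by (simp add: coeff_pderiv algebra_simps)
qed

lemma degree_wderiv_le: "degree (wderiv a b q) \<le> Suc (degree q)"
proof (rule degree_le, intro allI impI)
  fix i assume i: "Suc (degree q) < i"
  then obtain m where m: "i = Suc m" by (cases i) auto
  with i have "degree q \<le> m" "coeff q m = 0" by (auto intro: coeff_eq_0)
  then show "coeff (wderiv a b q) i = 0" using coeff_wderiv_top[of q m a b] m by simp
qed

lemma wderiv_nonzero:
  assumes "a + b > 0" and "q \<noteq> 0"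
  shows "wderiv a b q \<noteq> 0"
proof
  assume "wderiv a b q = 0"
  then have "(a + b + real (degree q)) * lead_coeff q = 0"
    using coeff_wderiv_top[of q "degree q" a b] by (simp add: algebra_simps)
  with assms show False by auto
qed

section \<open>Jacobi polynomials\<close>

text \<open>
  Rodrigues' formula without its normalizing constant.
\<close>

fun rodrigues_poly :: "nat \<Rightarrow> real \<Rightarrow> real \<Rightarrow> real poly" where
  "rodrigues_poly 0 a b = 1"
| "rodrigues_poly (Suc n) a b = wderiv (a + 1) (b + 1) (rodrigues_poly n (a + 1) (b + 1))"

lemma deriv_funpow_weight:
  assumes "x \<in> {-1<..<1}"
  shows "(deriv ^^ n) (\<lambda>y. (1 - y) powr (real n + a) * (1 + y) powr (real n + b)) x =
           (1 - x) powr a * (1 + x) powr b * poly (rodrigues_poly n a b) x"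
  using assms
proof (induction n arbitrary: a b x)
  case 0
  then show ?case by simp
next
  case (Suc n)
  let ?f = "(deriv ^^ n) (\<lambda>y::real. (1 - y) powr (real (Suc n) + a) * (1 + y) powr (real (Suc n) + b))"
  let ?r = "rodrigues_poly n (a + 1) (b + 1)"
  have f: "?f y = (1 - y) powr (a + 1) * (1 + y) powr (b + 1) * poly ?r y" if "y \<in> {-1<..<1}" for y
    using Suc.IH[OF that, of "a + 1" "b + 1"] by (simp add: algebra_simps)
  have "(?f has_real_derivative (1 - x) powr (a + 1 - 1) * (1 + x) powr (b + 1 - 1) *
          poly (wderiv (a + 1) (b + 1) ?r) x) (at x)"
    unfolding wderiv_def
    by (rule has_field_derivative_transform_within_open[OF jacobi_weight_deriv[OF Suc.prems],
          of "{-1<..<1}"]) (use Suc.prems f in auto)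
  then show ?case by (simp add: DERIV_imp_deriv)
qed

lemma jacobi_poly_eq:
  "jacobi_poly n a b = smult ((-1) ^ n / (2 ^ n * fact n)) (rodrigues_poly n a b)"
  unfolding jacobi_poly_def
proof (rule the1_equality[OF jacobi_poly_ex1], rule ballI)
  fix x :: real assume x: "x \<in> {-1<..<1}"
  then show "poly (smult ((-1) ^ n / (2 ^ n * fact n)) (rodrigues_poly n a b)) x =
               jacobi_rodrigues n a b x"
    unfolding jacobi_rodrigues_def deriv_funpow_weight[OF x] by (simp add: powr_minus field_simps)
qed

lemma degree_rodrigues_poly_le: "degree (rodrigues_poly n a b) \<le> n"
proof (induction n arbitrary: a b)
  case (Suc n)
  show ?case
    using degree_wderiv_le[of "a + 1" "b + 1" "rodrigues_poly n (a + 1) (b + 1)"]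
      Suc[of "a + 1" "b + 1"] by simp
qed simp

lemma rodrigues_poly_nonzero:
  assumes "a > -1" "b > -1"
  shows "rodrigues_poly n a b \<noteq> 0"
  using assms
proof (induction n arbitrary: a b)
  case (Suc n)
  then have "rodrigues_poly n (a + 1) (b + 1) \<noteq> 0" by simp
  with Suc.prems show ?case using wderiv_nonzero[of "a + 1" "b + 1"] by simp
qed simp

text \<open>
  Orthogonality of the Jacobi polynomial to all polynomials of smaller degree, with "has weighted
  integral \<open>0\<close>" read as "lies in the range of \<open>wderiv\<close>". Each step of the induction is one
  integration by parts: it moves a derivative onto \<open>g\<close>, which lowers the degree of \<open>g\<close>, and removes
  one of the \<open>n\<close> derivatives in Rodrigues' formula.
\<close>

lemma rodrigues_poly_mult_in_range:
  assumes "degree g < n"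
  shows "\<exists>h. rodrigues_poly n a b * g = wderiv (a + 1) (b + 1) h"
  using assms
proof (induction n arbitrary: a b g)
  case 0
  then show ?case by simp
next
  case (Suc n)
  let ?u = "rodrigues_poly n (a + 1) (b + 1)"
  obtain h where h: "?u * pderiv g = wderiv (a + 2) (b + 2) h"
  proof (cases "degree g = 0")
    case True
    then have "pderiv g = 0" by (simp add: pderiv_eq_0_iff)
    then show ?thesis by (intro that[of 0]) (simp add: wderiv_def)
  next
    case False
    then have "degree (pderiv g) < n" using Suc.prems by (simp add: degree_pderiv)
    from Suc.IH[OF this, of "a + 1" "b + 1"] show ?thesis
      using that by (auto simp: add.assoc)
  qed
  have "rodrigues_poly (Suc n) a b * g =
          wderiv (a + 1) (b + 1) (?u * g) - [:1, 0, -1:] * (?u * pderiv g)"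
    unfolding wderiv_mult by simp
  also have "[:1, 0, -1:] * (?u * pderiv g) = wderiv (a + 1) (b + 1) ([:1, 0, -1:] * h)"
    unfolding h wderiv_shift by (simp add: add.assoc)
  finally show ?case
    unfolding wderiv_diff[symmetric] by blast
qed

text \<open>
  Rolle's theorem, applied to the weighted polynomial one derivative earlier in Rodrigues' formula:
  its weight has positive exponents, so it vanishes at both ends of \<open>[-1, 1]\<close>.
\<close>

lemma rodrigues_poly_has_root:
  assumes "n \<ge> 1" "a > -1" "b > -1"
  shows "\<exists>x. poly (rodrigues_poly n a b) x = 0"
proof -
  obtain m where n: "n = Suc m" using assms(1) by (cases n) auto
  let ?u = "rodrigues_poly m (a + 1) (b + 1)"
  let ?F = "\<lambda>y. (1 - y) powr (a + 1) * (1 + y) powr (b + 1) * poly ?u y"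
  have der: "(?F has_real_derivative
      (1 - x) powr a * (1 + x) powr b * poly (rodrigues_poly n a b) x) (at x)"
    if "-1 < x" "x < 1" for x
    using jacobi_weight_deriv[of x "a + 1" "b + 1" ?u] that n by (simp add: wderiv_def)
  have "\<exists>z::real>-1. z < 1 \<and> DERIV ?F z :> 0"
  proof (rule Rolle)
    show "continuous_on {-1..1} ?F"
      using assms by (intro continuous_intros continuous_on_powr') auto
    show "?F differentiable (at x)" if "-1 < x" "x < 1" for x
      using der[OF that] by (auto simp: real_differentiable_def)
  qed (use assms in auto)
  then obtain z where z: "-1 < z" "z < 1" "DERIV ?F z :> 0" by blast
  with DERIV_unique[OF z(3) der[OF z(1,2)]] show ?thesis by auto
qed

section \<open>Polynomial functions on Euclidean space\<close>

lemma poly_fun_deg_le_monomial: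
  fixes m :: "'n::finite \<Rightarrow> nat"
  assumes "(\<Sum>i\<in>UNIV. m i) \<le> k"
  shows "poly_fun_deg_le k (\<lambda>x. \<Prod>i\<in>UNIV. (x $ i) ^ m i)"
  unfolding poly_fun_deg_le_def
proof (intro exI[of _ "\<lambda>m'. if m' = m then 1 else 0"] allI)
  fix x :: "real^'n"
  have "(\<Sum>m' | (\<Sum>i\<in>UNIV. m' i) \<le> k. (if m' = m then 1 else 0) * (\<Prod>i\<in>UNIV. (x $ i) ^ m' i)) =
        (\<Sum>m' | (\<Sum>i\<in>UNIV. m' i) \<le> k. if m' = m then \<Prod>i\<in>UNIV. (x $ i) ^ m i else 0)"
    by (intro sum.cong) auto
  then show "(\<Prod>i\<in>UNIV. (x $ i) ^ m i) = (\<Sum>m' | (\<Sum>i\<in>UNIV. m' i) \<le> k.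
      (if m' = m then 1 else 0) * (\<Prod>i\<in>UNIV. (x $ i) ^ m' i))"
    using assms finite_exponents[where 'n='n, of k] by simp
qed

lemma poly_fun_deg_le_add:
  assumes "poly_fun_deg_le k f" "poly_fun_deg_le k g"
  shows "poly_fun_deg_le k (\<lambda>x. f x + g x)"
proof -
  obtain c c' where
    "\<And>x. f x = (\<Sum>m | (\<Sum>i\<in>UNIV. m i) \<le> k. c m * (\<Prod>i\<in>UNIV. (x $ i) ^ m i))"
    "\<And>x. g x = (\<Sum>m | (\<Sum>i\<in>UNIV. m i) \<le> k. c' m * (\<Prod>i\<in>UNIV. (x $ i) ^ m i))"
    using assms unfolding poly_fun_deg_le_def by blast
  then show ?thesis unfolding poly_fun_deg_le_def
    by (intro exI[of _ "\<lambda>m. c m + c' m"]) (simp add: sum.distrib algebra_simps)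
qed

lemma poly_fun_deg_le_cmult:
  assumes "poly_fun_deg_le k f"
  shows "poly_fun_deg_le k (\<lambda>x. r * f x)"
proof -
  obtain c where
    "\<And>x. f x = (\<Sum>m | (\<Sum>i\<in>UNIV. m i) \<le> k. c m * (\<Prod>i\<in>UNIV. (x $ i) ^ m i))"
    using assms unfolding poly_fun_deg_le_def by blast
  then show ?thesis unfolding poly_fun_deg_le_def
    by (intro exI[of _ "\<lambda>m. r * c m"]) (simp add: sum_distrib_left mult.assoc)
qed

lemma poly_fun_deg_le_zero: "poly_fun_deg_le k (\<lambda>x. 0)"
  unfolding poly_fun_deg_le_def by (intro exI[of _ "\<lambda>_. 0"]) simp

lemma poly_fun_deg_le_sum:
  assumes "\<And>s. s \<in> S \<Longrightarrow> poly_fun_deg_le k (f s)"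
  shows "poly_fun_deg_le k (\<lambda>x. \<Sum>s\<in>S. f s x)"
  using assms
  by (induction S rule: infinite_finite_induct) (auto intro: poly_fun_deg_le_zero poly_fun_deg_le_add)

lemma poly_fun_deg_le_mult:
  fixes f g :: "real^'n::finite \<Rightarrow> real"
  assumes "poly_fun_deg_le k f" "poly_fun_deg_le l g"
  shows "poly_fun_deg_le (k + l) (\<lambda>x. f x * g x)"
proof -
  obtain c c' where
    f: "\<And>x. f x = (\<Sum>m | (\<Sum>i\<in>UNIV. m i) \<le> k. c m * (\<Prod>i\<in>UNIV. (x $ i) ^ m i))" and
    g: "\<And>x. g x = (\<Sum>m | (\<Sum>i\<in>UNIV. m i) \<le> l. c' m * (\<Prod>i\<in>UNIV. (x $ i) ^ m i))"
    using assms unfolding poly_fun_deg_le_def by blast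
  have "(\<lambda>x. f x * g x) = (\<lambda>x. \<Sum>m | (\<Sum>i\<in>UNIV. m i) \<le> k. \<Sum>m' | (\<Sum>i\<in>UNIV. m' i) \<le> l.
          (c m * c' m') * (\<Prod>i\<in>UNIV. (x $ i) ^ (m i + m' i)))"
    unfolding f g sum_product by (simp add: power_add prod.distrib algebra_simps)
  moreover have "poly_fun_deg_le (k + l) (\<lambda>x. \<Sum>m | (\<Sum>i\<in>UNIV. m i) \<le> k.
        \<Sum>m' | (\<Sum>i\<in>UNIV. m' i) \<le> l.
          (c m * c' m') * (\<Prod>i\<in>UNIV. ((x::real^'n) $ i) ^ (m i + m' i)))"
    by (intro poly_fun_deg_le_sum poly_fun_deg_le_cmult poly_fun_deg_le_monomial)
      (auto simp: sum.distrib intro: add_mono)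
  ultimately show ?thesis by simp
qed

lemma poly_fun_deg_le_one: "poly_fun_deg_le 0 (\<lambda>x::real^'n. 1)"
  using poly_fun_deg_le_monomial[of "\<lambda>_::'n. 0" 0] by simp

lemma poly_fun_deg_le_component: "poly_fun_deg_le 1 (\<lambda>x::real^'n. x $ j)"
proof -
  have "(\<lambda>x::real^'n. \<Prod>i\<in>UNIV. (x $ i) ^ (if i = j then 1 else 0)) = (\<lambda>x. x $ j)"
  proof
    fix x :: "real^'n"
    have "(\<Prod>i\<in>UNIV. (x $ i) ^ (if i = j then 1 else 0)) = (\<Prod>i\<in>UNIV. if i = j then x $ i else 1)"
      by (intro prod.cong) auto
    then show "(\<Prod>i\<in>UNIV. (x $ i) ^ (if i = j then 1 else 0)) = x $ j" by simp
  qed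
  then show ?thesis
    using poly_fun_deg_le_monomial[of "\<lambda>i. if i = j then 1 else 0" 1] by simp
qed

lemma poly_fun_deg_le_power:
  assumes "poly_fun_deg_le k f"
  shows "poly_fun_deg_le (i * k) (\<lambda>x::real^'n. f x ^ i)"
proof (induction i)
  case 0
  show ?case using poly_fun_deg_le_one by simp
next
  case (Suc i)
  show ?case using poly_fun_deg_le_mult[OF assms Suc] by simp
qed

lemma poly_fun_deg_le_inner_self: "poly_fun_deg_le 2 (\<lambda>x::real^'n. x \<bullet> x)"
proof -
  have "poly_fun_deg_le (1 + 1) (\<lambda>x::real^'n. \<Sum>i\<in>UNIV. x $ i * x $ i)"
    by (intro poly_fun_deg_le_sum poly_fun_deg_le_mult poly_fun_deg_le_component)
  then show ?thesis by (simp add: inner_vec_def numeral_2_eq_2)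
qed

lemma poly_fun_deg_le_mono:
  fixes f :: "real^'n::finite \<Rightarrow> real"
  assumes "poly_fun_deg_le k f" "k \<le> l"
  shows "poly_fun_deg_le l f"
proof -
  obtain c where
    f: "\<And>x. f x = (\<Sum>m | (\<Sum>i\<in>UNIV. m i) \<le> k. c m * (\<Prod>i\<in>UNIV. (x $ i) ^ m i))"
    using assms unfolding poly_fun_deg_le_def by blast
  have "poly_fun_deg_le l (\<lambda>x::real^'n. \<Sum>m | (\<Sum>i\<in>UNIV. m i) \<le> k. c m * (\<Prod>i\<in>UNIV. (x $ i) ^ m i))"
    by (intro poly_fun_deg_le_sum poly_fun_deg_le_cmult poly_fun_deg_le_monomial)
      (use assms(2) in auto)
  then show ?thesis unfolding f[symmetric] .
qed

section \<open>Zonal harmonics\<close>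

text \<open>
  The iterated \<^const>\<open>deriv\<close> in \<^const>\<open>laplacian\<close> need not be additive without differentiability. This
  predicate carries differentiability along with the values of the pure second derivatives.
\<close>

definition second_partials :: "(real^'n \<Rightarrow> real) \<Rightarrow> ('n \<Rightarrow> real^'n \<Rightarrow> real) \<Rightarrow> bool" where
  "second_partials f f2 \<longleftrightarrow> (\<exists>f1. \<forall>i x.
     ((\<lambda>s. f (x + s *\<^sub>R axis i 1)) has_real_derivative f1 i x) (at 0) \<and>
     ((\<lambda>s. f1 i (x + s *\<^sub>R axis i 1)) has_real_derivative f2 i x) (at 0))"

lemma laplacian_second_partials:
  assumes "second_partials f f2"
  shows "laplacian f x = (\<Sum>i\<in>UNIV. f2 i x)"
proof -
  obtain f1 where
    1: "\<And>i x. ((\<lambda>s. f (x + s *\<^sub>R axis i 1)) has_real_derivative f1 i x) (at 0)" and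
    2: "\<And>i x. ((\<lambda>s. f1 i (x + s *\<^sub>R axis i 1)) has_real_derivative f2 i x) (at 0)"
    using assms unfolding second_partials_def by blast
  have "partial_deriv i f = f1 i" for i
    by (rule ext) (simp add: partial_deriv_def DERIV_imp_deriv[OF 1])
  then show ?thesis
    by (simp add: laplacian_def partial_deriv_def DERIV_imp_deriv[OF 2])
qed

lemma second_partials_sum:
  assumes "\<And>k. k \<in> K \<Longrightarrow> second_partials (f k) (f2 k)"
  shows "second_partials (\<lambda>x. \<Sum>k\<in>K. c k * f k x) (\<lambda>i x. \<Sum>k\<in>K. c k * f2 k i x)"
proof -
  have "\<forall>k\<in>K. \<exists>f1. \<forall>i x.
     ((\<lambda>s. f k (x + s *\<^sub>R axis i 1)) has_real_derivative f1 i x) (at 0) \<and>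
     ((\<lambda>s. f1 i (x + s *\<^sub>R axis i 1)) has_real_derivative f2 k i x) (at 0)"
    using assms unfolding second_partials_def by blast
  then obtain f1 where f1: "\<forall>k\<in>K. \<forall>i x.
     ((\<lambda>s. f k (x + s *\<^sub>R axis i 1)) has_real_derivative f1 k i x) (at 0) \<and>
     ((\<lambda>s. f1 k i (x + s *\<^sub>R axis i 1)) has_real_derivative f2 k i x) (at 0)"
    by (rule bchoice[elim_format]) blast
  show ?thesis unfolding second_partials_def
    by (rule exI[of _ "\<lambda>i x. \<Sum>k\<in>K. c k * f1 k i x"])
      (use f1 in \<open>auto intro!: DERIV_sum DERIV_cmult\<close>)
qed

lemma DERIV_power_mult_power:
  fixes t r :: "real \<Rightarrow> real"
  assumes "(t has_real_derivative d) (at z)" "(r has_real_derivative e) (at z)"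
  shows "((\<lambda>s. t s ^ m * r s ^ i) has_real_derivative
           real m * d * t z ^ (m - 1) * r z ^ i + real i * e * t z ^ m * r z ^ (i - 1)) (at z)"
  using DERIV_mult[OF DERIV_power[OF assms(1), of m] DERIV_power[OF assms(2), of i]]
  by (simp add: algebra_simps)

text \<open>
  With \<open>t = x $ N\<close> and \<open>\<rho> = x \<bullet> x\<close>, the monomials \<open>t ^ m * \<rho> ^ i\<close> span the rotationally symmetric
  polynomials about the axis \<open>N\<close>. Truncated subtraction in the exponents is harmless, since each such
  exponent comes with a factor that vanishes where truncation happens.
\<close>

lemma second_partials_component_norm:
  fixes N :: "'n::finite"
  shows "second_partials (\<lambda>x::real^'n. (x $ N) ^ m * (x \<bullet> x) ^ i)
     (\<lambda>l x. (if l = N then real m * real (m - 1) * (x $ N) ^ (m - 2) * (x \<bullet> x) ^ i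
                          + 4 * real m * real i * (x $ N) ^ m * (x \<bullet> x) ^ (i - 1) else 0)
            + 2 * real i * (x $ N) ^ m * (x \<bullet> x) ^ (i - 1)
            + 4 * real i * real (i - 1) * (x $ l) ^ 2 * (x $ N) ^ m * (x \<bullet> x) ^ (i - 2))"
proof -
  have comp: "((\<lambda>s. (x + s *\<^sub>R axis l 1) $ k) has_real_derivative (if l = k then 1 else 0)) (at 0)"
    for l k and x :: "real^'n"
    by (auto simp: axis_def intro!: derivative_eq_intros)
  have nrm: "((\<lambda>s. (x + s *\<^sub>R axis l 1) \<bullet> (x + s *\<^sub>R axis l 1)) has_real_derivative 2 * x $ l) (at 0)"
    for l and x :: "real^'n"
    by (auto simp: inner_add_left inner_add_right inner_axis inner_commute[of "axis _ _"]
        intro!: derivative_eq_intros)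
  show ?thesis unfolding second_partials_def
  proof (rule exI[of _ "\<lambda>l x. (if l = N then real m * (x $ N) ^ (m - 1) * (x \<bullet> x) ^ i else 0) +
      2 * real i * x $ l * ((x $ N) ^ m * (x \<bullet> x) ^ (i - 1))"], intro allI conjI)
    fix l and x :: "real^'n"
    define t where "t = (\<lambda>s. (x + s *\<^sub>R axis l 1) $ N)"
    define u where "u = (\<lambda>s. (x + s *\<^sub>R axis l 1) $ l)"
    define r where "r = (\<lambda>s. (x + s *\<^sub>R axis l 1) \<bullet> (x + s *\<^sub>R axis l 1))"
    have t: "(t has_real_derivative (if l = N then 1 else 0)) (at 0)"
      and u: "(u has_real_derivative 1) (at 0)" and r: "(r has_real_derivative 2 * x $ l) (at 0)"
      using comp[of x l N] comp[of x l l] nrm[of x l] unfolding t_def u_def r_def by simp_all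
    have 0: "t 0 = x $ N" "u 0 = x $ l" "r 0 = x \<bullet> x"
      by (simp_all add: t_def u_def r_def)
    show "((\<lambda>s. ((x + s *\<^sub>R axis l 1) $ N) ^ m * ((x + s *\<^sub>R axis l 1) \<bullet> (x + s *\<^sub>R axis l 1)) ^ i)
       has_real_derivative (if l = N then real m * (x $ N) ^ (m - 1) * (x \<bullet> x) ^ i else 0) +
      2 * real i * x $ l * ((x $ N) ^ m * (x \<bullet> x) ^ (i - 1))) (at 0)"
      using DERIV_power_mult_power[OF t r, of m i]
      unfolding 0 by (simp add: t_def r_def algebra_simps split: if_splits)
    have tm: "real m * (x $ N * (x $ N) ^ (m - Suc 0)) = real m * (x $ N) ^ m"
      by (cases m) simp_all
    have d1: "((\<lambda>s. if l = N then real m * (t s ^ (m - 1) * r s ^ i) else 0) has_real_derivative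
        (if l = N then real m * (real (m - 1) * (x $ N) ^ (m - 2) * (x \<bullet> x) ^ i +
           real i * (2 * x $ l) * (x $ N) ^ (m - 1) * (x \<bullet> x) ^ (i - 1)) else 0)) (at 0)"
      using DERIV_cmult[OF DERIV_power_mult_power[OF t r, of "m - 1" i], of "real m"]
      unfolding 0 by (cases "l = N") (simp_all add: diff_diff_left numeral_2_eq_2)
    have d2: "((\<lambda>s. 2 * real i * (u s * (t s ^ m * r s ^ (i - 1)))) has_real_derivative
        2 * real i * (1 * ((x $ N) ^ m * (x \<bullet> x) ^ (i - 1)) +
          (real m * (if l = N then 1 else 0) * (x $ N) ^ (m - 1) * (x \<bullet> x) ^ (i - 1) +
           real (i - 1) * (2 * x $ l) * (x $ N) ^ m * (x \<bullet> x) ^ (i - 2)) * x $ l)) (at 0)"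
      using DERIV_cmult[OF DERIV_mult[OF u DERIV_power_mult_power[OF t r, of m "i - 1"]], of "2 * real i"]
      unfolding 0 by (simp add: diff_diff_left numeral_2_eq_2)
    have fn: "(if l = N then real m * ((x + s *\<^sub>R axis l 1) $ N) ^ (m - 1) *
         ((x + s *\<^sub>R axis l 1) \<bullet> (x + s *\<^sub>R axis l 1)) ^ i else 0) +
      2 * real i * (x + s *\<^sub>R axis l 1) $ l * (((x + s *\<^sub>R axis l 1) $ N) ^ m *
         ((x + s *\<^sub>R axis l 1) \<bullet> (x + s *\<^sub>R axis l 1)) ^ (i - 1)) =
      (if l = N then real m * (t s ^ (m - 1) * r s ^ i) else 0) +
      2 * real i * (u s * (t s ^ m * r s ^ (i - 1)))" for s
      unfolding t_def u_def r_def by (simp add: mult.assoc)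
    have val: "(if l = N then real m * real (m - 1) * (x $ N) ^ (m - 2) * (x \<bullet> x) ^ i
                          + 4 * real m * real i * (x $ N) ^ m * (x \<bullet> x) ^ (i - 1) else 0)
            + 2 * real i * (x $ N) ^ m * (x \<bullet> x) ^ (i - 1)
            + 4 * real i * real (i - 1) * (x $ l) ^ 2 * (x $ N) ^ m * (x \<bullet> x) ^ (i - 2) =
        (if l = N then real m * (real (m - 1) * (x $ N) ^ (m - 2) * (x \<bullet> x) ^ i +
           real i * (2 * x $ l) * (x $ N) ^ (m - 1) * (x \<bullet> x) ^ (i - 1)) else 0) +
        2 * real i * (1 * ((x $ N) ^ m * (x \<bullet> x) ^ (i - 1)) +
          (real m * (if l = N then 1 else 0) * (x $ N) ^ (m - 1) * (x \<bullet> x) ^ (i - 1) +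
           real (i - 1) * (2 * x $ l) * (x $ N) ^ m * (x \<bullet> x) ^ (i - 2)) * x $ l)"
      using arg_cong[OF tm, of "\<lambda>y. 4 * real i * (x \<bullet> x) ^ (i - 1) * y"]
      by (auto simp: power2_eq_square algebra_simps)
    show "((\<lambda>s. (if l = N then real m * ((x + s *\<^sub>R axis l 1) $ N) ^ (m - 1) *
         ((x + s *\<^sub>R axis l 1) \<bullet> (x + s *\<^sub>R axis l 1)) ^ i else 0) +
      2 * real i * (x + s *\<^sub>R axis l 1) $ l * (((x + s *\<^sub>R axis l 1) $ N) ^ m *
         ((x + s *\<^sub>R axis l 1) \<bullet> (x + s *\<^sub>R axis l 1)) ^ (i - 1)))
       has_real_derivative
       (if l = N then real m * real (m - 1) * (x $ N) ^ (m - 2) * (x \<bullet> x) ^ i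
                          + 4 * real m * real i * (x $ N) ^ m * (x \<bullet> x) ^ (i - 1) else 0)
            + 2 * real i * (x $ N) ^ m * (x \<bullet> x) ^ (i - 1)
            + 4 * real i * real (i - 1) * (x $ l) ^ 2 * (x $ N) ^ m * (x \<bullet> x) ^ (i - 2)) (at 0)"
      unfolding fn val by (rule DERIV_add[OF d1 d2])
  qed
qed

lemma sum_second_partials_component_norm:
  fixes N :: "'n::finite" and x :: "real^'n"
  shows "(\<Sum>l\<in>UNIV. (if l = N then real m * real (m - 1) * (x $ N) ^ (m - 2) * (x \<bullet> x) ^ i
                          + 4 * real m * real i * (x $ N) ^ m * (x \<bullet> x) ^ (i - 1) else 0)
            + 2 * real i * (x $ N) ^ m * (x \<bullet> x) ^ (i - 1)
            + 4 * real i * real (i - 1) * (x $ l) ^ 2 * (x $ N) ^ m * (x \<bullet> x) ^ (i - 2)) =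
         real m * real (m - 1) * (x $ N) ^ (m - 2) * (x \<bullet> x) ^ i +
         2 * real i * (2 * real m + 2 * real i + real CARD('n) - 2) * (x $ N) ^ m * (x \<bullet> x) ^ (i - 1)"
proof -
  have sq: "(\<Sum>l\<in>UNIV. 4 * real i * real (i - 1) * (x $ l) ^ 2 * (x $ N) ^ m * (x \<bullet> x) ^ (i - 2)) =
      4 * real i * real (i - 1) * (x $ N) ^ m * ((x \<bullet> x) * (x \<bullet> x) ^ (i - 2))"
    by (simp add: inner_vec_def power2_eq_square sum_distrib_left sum_distrib_right mult_ac)
  have i: "real i * real (i - 1) * ((x \<bullet> x) * (x \<bullet> x) ^ (i - 2)) =
           real i * (real i - 1) * (x \<bullet> x) ^ (i - 1)"
  proof -
    consider "i = 0" | "i = 1" | k where "i = Suc (Suc k)" by (metis One_nat_def not0_implies_Suc)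
    then show ?thesis by cases auto
  qed
  show ?thesis unfolding sum.distrib sq
    using arg_cong[OF i, of "\<lambda>y. 4 * (x $ N) ^ m * y"] by (simp add: algebra_simps)
qed

text \<open>
  The Gegenbauer coefficients in dimension \<open>D\<close>, scaled to leading coefficient \<open>1\<close>: the recurrence is
  the condition for \<open>\<Sum>i. c i * t ^ (j - 2 * i) * \<rho> ^ i\<close> to be harmonic.
\<close>

fun zonal_coeff :: "real \<Rightarrow> nat \<Rightarrow> nat \<Rightarrow> real" where
  "zonal_coeff D j 0 = 1"
| "zonal_coeff D j (Suc i) =
     - (real (j - 2 * i) * real (j - 2 * i - 1)) /
       (2 * real (Suc i) * (2 * real j - 2 * real (Suc i) + D - 2)) * zonal_coeff D j i"

text \<open>
  In the Laplacian of a solid zonal harmonic the second half of the term \<open>i + 1\<close> cancels the first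
  half of the term \<open>i\<close>. The sum is stated for independent \<open>t\<close> and \<open>r\<close> because it serves twice: with
  \<open>r = x \<bullet> x\<close> it is harmonicity, and with \<open>r = 1\<close> it is the eigenvalue equation on the sphere.
\<close>

lemma zonal_telescope:
  fixes t r :: real
  assumes "D \<ge> 2"
  shows "(\<Sum>i\<le>j div 2. zonal_coeff D j i *
       (real (j - 2 * i) * real (j - 2 * i - 1) * t ^ (j - 2 * i - 2) * r ^ i +
        2 * real i * (2 * real (j - 2 * i) + 2 * real i + D - 2) * t ^ (j - 2 * i) * r ^ (i - 1))) = 0"
proof -
  let ?A = "\<lambda>i. zonal_coeff D j i *
       (real (j - 2 * i) * real (j - 2 * i - 1) * t ^ (j - 2 * i - 2) * r ^ i)"
  let ?B = "\<lambda>i. zonal_coeff D j i *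
       (2 * real i * (2 * real (j - 2 * i) + 2 * real i + D - 2) * t ^ (j - 2 * i) * r ^ (i - 1))"
  \<comment> \<open>By telescoping, the partial sums are the uncancelled first halves.\<close>
  have tel: "(\<Sum>i\<le>M. ?A i + ?B i) = ?A M" if "M \<le> j div 2" for M
    using that
  proof (induction M)
    case 0
    show ?case by simp
  next
    case (Suc M)
    have e: "2 * real (j - 2 * Suc M) + 2 * real (Suc M) + D - 2 =
             2 * real j - 2 * real (Suc M) + D - 2"
      using Suc.prems by (simp add: of_nat_diff)
    have "2 * Suc M \<le> j" using Suc.prems by simp
    then have "2 * real (Suc M) \<le> real j" by linarith
    then have nz: "2 * real j - 2 * real (Suc M) + D - 2 > 0"
      using assms by simp
    have "zonal_coeff D j (Suc M) * (2 * real (Suc M) * (2 * real j - 2 * real (Suc M) + D - 2)) =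
          - (real (j - 2 * M) * real (j - 2 * M - 1)) * zonal_coeff D j M"
    proof -
      have cancel: "X / E * c * E = X * c" if "E \<noteq> 0" for X E c :: real
        using that by simp
      show ?thesis unfolding zonal_coeff.simps(2) by (rule cancel) (use nz in simp)
    qed
    then have "?B (Suc M) = - ?A M"
      unfolding e by (simp del: of_nat_Suc zonal_coeff.simps add: mult.assoc[symmetric])
    then show ?case using Suc by simp
  qed
  \<comment> \<open>The last exponent is \<open>0\<close> or \<open>1\<close>, so the remaining first half vanishes.\<close>
  have "j - 2 * (j div 2) = j mod 2" by presburger
  then have "?A (j div 2) = 0"
    by (cases "j mod 2 = 0") (auto simp: mod2_eq_if)
  then show ?thesis using tel[of "j div 2"] by (simp add: distrib_left)
qed

definition zonal_poly :: "real \<Rightarrow> nat \<Rightarrow> real poly" where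
  "zonal_poly D j = (\<Sum>i\<le>j div 2. monom (zonal_coeff D j i) (j - 2 * i))"

definition solid_zonal :: "'n::finite \<Rightarrow> nat \<Rightarrow> real^'n \<Rightarrow> real" where
  "solid_zonal N j x =
     (\<Sum>i\<le>j div 2. zonal_coeff (real CARD('n)) j i * ((x $ N) ^ (j - 2 * i) * (x \<bullet> x) ^ i))"

lemma degree_zonal_poly_le: "degree (zonal_poly D j) \<le> j"
  unfolding zonal_poly_def
  by (intro degree_sum_le) (auto intro: order.trans[OF degree_monom_le])

lemma coeff_zonal_poly_top: "coeff (zonal_poly D j) j = 1"
proof -
  have "coeff (zonal_poly D j) j = (\<Sum>i\<le>j div 2. if i = 0 then 1 else 0)"
    unfolding zonal_poly_def coeff_sum by (intro sum.cong) auto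
  then show ?thesis by simp
qed

lemma solid_zonal_sphere:
  fixes x :: "real^'n::finite"
  assumes "x \<in> sphere 0 1"
  shows "solid_zonal N j x = poly (zonal_poly (real CARD('n)) j) (x $ N)"
proof -
  have "x \<bullet> x = 1" using assms by (simp add: norm_eq_1)
  then show ?thesis by (simp add: solid_zonal_def zonal_poly_def poly_sum poly_monom)
qed

text \<open>
  After adding the eigenvalue term, the coefficient of \<open>t ^ m\<close> with \<open>m = j - 2 * i\<close> is
  \<open>j * (j + D - 2) - m * (m + D - 2) = 2 * i * (2 * m + 2 * i + D - 2)\<close>,
  which is the one in \<open>zonal_telescope\<close>.
\<close>

lemma zonal_poly_eigen:
  assumes "D \<ge> 2"
  shows "wderiv ((D - 1) / 2) ((D - 1) / 2) (pderiv (zonal_poly D j)) =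
           smult (- (real j * (real j + D - 2))) (zonal_poly D j)"
proof (rule poly_ext)
  fix t
  have mon: "poly (wderiv ((D - 1) / 2) ((D - 1) / 2) (pderiv (monom c m))) t =
        c * (real m * real (m - 1) * t ^ (m - 2) - real m * (real m + D - 2) * t ^ m)" for c m
  proof -
    consider "m = 0" | "m = 1" | k where "m = Suc (Suc k)" by (metis One_nat_def not0_implies_Suc)
    then show ?thesis
      by cases (simp_all add: wderiv_def pderiv_monom poly_monom field_simps)
  qed
  have add: "wderiv a b (p + q) = wderiv a b p + wderiv a b q" for a b p q
    by (rule poly_ext) (simp add: wderiv_def pderiv_add algebra_simps)
  have lin: "wderiv a b (pderiv (\<Sum>i\<in>I. p i)) = (\<Sum>i\<in>I. wderiv a b (pderiv (p i)))" for a b p and I :: "nat set"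
    by (induction I rule: infinite_finite_induct) (simp_all add: pderiv_add add wderiv_def[of _ _ 0])
  have "poly (wderiv ((D - 1) / 2) ((D - 1) / 2) (pderiv (zonal_poly D j))) t
      + real j * (real j + D - 2) * poly (zonal_poly D j) t =
     (\<Sum>i\<le>j div 2. zonal_coeff D j i *
       (real (j - 2 * i) * real (j - 2 * i - 1) * t ^ (j - 2 * i - 2) * 1 ^ i +
        2 * real i * (2 * real (j - 2 * i) + 2 * real i + D - 2) * t ^ (j - 2 * i) * 1 ^ (i - 1)))"
    unfolding zonal_poly_def lin poly_sum mon sum_distrib_left sum.distrib[symmetric] poly_monom
  proof (intro sum.cong refl, goal_cases)
    case (1 i)
    then have "2 * i \<le> j" by simp
    then show ?case by (simp add: of_nat_diff algebra_simps)
  qed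
  also have "\<dots> = 0" by (rule zonal_telescope[OF assms])
  finally show "poly (wderiv ((D - 1) / 2) ((D - 1) / 2) (pderiv (zonal_poly D j))) t =
      poly (smult (- (real j * (real j + D - 2))) (zonal_poly D j)) t"
    by (simp add: algebra_simps)
qed

text \<open>
  Harmonic polynomials in a form that is visibly closed under linear combinations.
\<close>

definition smooth_harmonic :: "nat \<Rightarrow> (real^'n::finite \<Rightarrow> real) \<Rightarrow> bool" where
  "smooth_harmonic k f \<longleftrightarrow>
     poly_fun_deg_le k f \<and> (\<exists>f2. second_partials f f2 \<and> (\<forall>x. (\<Sum>l\<in>UNIV. f2 l x) = 0))"

lemma smooth_harmonic_imp_harmonic_poly: "smooth_harmonic k f \<Longrightarrow> harmonic_poly k f"
  unfolding smooth_harmonic_def harmonic_poly_def by (auto simp: laplacian_second_partials)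

lemma smooth_harmonic_zero: "smooth_harmonic k (\<lambda>x. 0)"
  unfolding smooth_harmonic_def second_partials_def
  by (auto intro!: poly_fun_deg_le_zero exI[of _ "\<lambda>_ _. 0"])

lemma smooth_harmonic_add_cmult:
  assumes "smooth_harmonic k f" "smooth_harmonic l g" "k \<le> l"
  shows "smooth_harmonic l (\<lambda>x. f x + c * g x)"
proof -
  obtain f2 g2 where f2: "second_partials f f2" "\<And>x. (\<Sum>l\<in>UNIV. f2 l x) = 0"
    and g2: "second_partials g g2" "\<And>x. (\<Sum>l\<in>UNIV. g2 l x) = 0"
    using assms unfolding smooth_harmonic_def by blast
  have "second_partials (\<lambda>x. \<Sum>b\<in>UNIV. (if b then 1 else c) * (if b then f else g) x)
      (\<lambda>i x. \<Sum>b\<in>UNIV. (if b then 1 else c) * (if b then f2 else g2) i x)"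
    by (rule second_partials_sum) (use f2 g2 in auto)
  then have "second_partials (\<lambda>x. f x + c * g x) (\<lambda>i x. f2 i x + c * g2 i x)"
    by (simp add: UNIV_bool add.commute)
  moreover have "(\<Sum>i\<in>UNIV. f2 i x + c * g2 i x) = 0" for x
    using f2 g2 by (simp add: sum.distrib sum_distrib_left[symmetric])
  ultimately show ?thesis
    using assms unfolding smooth_harmonic_def
    by (auto intro!: poly_fun_deg_le_add poly_fun_deg_le_cmult intro: poly_fun_deg_le_mono)
qed

lemma smooth_harmonic_solid_zonal:
  assumes "CARD('n::finite) \<ge> 2"
  shows "smooth_harmonic j (solid_zonal (N::'n) j)"
proof -
  let ?f = "\<lambda>i x::real^'n. (x $ N) ^ (j - 2 * i) * (x \<bullet> x) ^ i"
  have eq: "solid_zonal N j = (\<lambda>x. \<Sum>i\<le>j div 2. zonal_coeff (real CARD('n)) j i * ?f i x)"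
    by (rule ext) (simp add: solid_zonal_def)
  have "poly_fun_deg_le j (?f i)" if "i \<le> j div 2" for i
  proof -
    have "poly_fun_deg_le ((j - 2 * i) * 1 + i * 2) (?f i)"
      by (intro poly_fun_deg_le_mult poly_fun_deg_le_power poly_fun_deg_le_component
          poly_fun_deg_le_inner_self)
    then show ?thesis using that by (simp add: mult.commute)
  qed
  then have "poly_fun_deg_le j (solid_zonal N j)"
    unfolding eq by (intro poly_fun_deg_le_sum poly_fun_deg_le_cmult) auto
  moreover have "\<exists>f2. second_partials (solid_zonal N j) f2 \<and> (\<forall>x. (\<Sum>l\<in>UNIV. f2 l x) = 0)"
    unfolding eq
  proof (rule exI, rule conjI[OF second_partials_sum[OF second_partials_component_norm]], rule allI)
    fix x :: "real^'n"
    show "(\<Sum>l\<in>UNIV. \<Sum>i\<le>j div 2. zonal_coeff (real CARD('n)) j i *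
        ((if l = N then real (j - 2 * i) * real (j - 2 * i - 1) * (x $ N) ^ (j - 2 * i - 2) * (x \<bullet> x) ^ i
                          + 4 * real (j - 2 * i) * real i * (x $ N) ^ (j - 2 * i) * (x \<bullet> x) ^ (i - 1) else 0)
            + 2 * real i * (x $ N) ^ (j - 2 * i) * (x \<bullet> x) ^ (i - 1)
            + 4 * real i * real (i - 1) * (x $ l) ^ 2 * (x $ N) ^ (j - 2 * i) * (x \<bullet> x) ^ (i - 2))) = 0"
      unfolding sum.swap[of _ _ UNIV] sum_distrib_left[symmetric] sum_second_partials_component_norm
      by (rule zonal_telescope) (use assms in simp)
  qed
  ultimately show ?thesis unfolding smooth_harmonic_def by blast
qed

text \<open>
  The operator \<open>g \<mapsto> wderiv _ _ (pderiv g)\<close> multiplies the zonal harmonic of degree \<open>j\<close> by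
  \<open>- j * (j + D - 2)\<close>, so it annihilates the constant part of \<open>g\<close>, and with it the only zonal harmonic
  whose extension is nonzero at the origin. The induction peels off the zonal harmonic of top degree.
\<close>

lemma zonal_harmonic_extension:
  fixes N :: "'n::finite"
  assumes "CARD('n) \<ge> 2" and "degree g \<le> k"
  shows "\<exists>f. smooth_harmonic k f \<and> f 0 = 0 \<and> (\<forall>x\<in>sphere 0 1. f x =
           poly (wderiv ((real CARD('n) - 1) / 2) ((real CARD('n) - 1) / 2) (pderiv g)) (x $ N))"
  using assms(2)
proof (induction k arbitrary: g)
  case 0
  then have "pderiv g = 0" by (simp add: pderiv_eq_0_iff)
  then show ?case
    by (intro exI[of _ "\<lambda>_. 0"]) (simp add: smooth_harmonic_zero wderiv_def)
next
  case (Suc k)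
  let ?D = "real CARD('n)" and ?j = "Suc k"
  let ?L = "\<lambda>g. wderiv ((?D - 1) / 2) ((?D - 1) / 2) (pderiv g)"
  \<comment> \<open>Zonal polynomials are monic, so this multiple of \<open>Z\<close> removes the top coefficient of \<open>g\<close>.\<close>
  define c where "c = coeff g ?j"
  define Z where "Z = zonal_poly ?D ?j"
  define g' where "g' = g - smult c Z"
  have "degree g' \<le> k"
  proof (rule degree_le, intro allI impI)
    fix i assume i: "k < i"
    show "coeff g' i = 0"
    proof (cases "i = ?j")
      case True
      then show ?thesis by (simp add: g'_def c_def Z_def coeff_zonal_poly_top del: of_nat_Suc)
    next
      case False
      with i have "?j < i" by simp
      then have "coeff g i = 0" "coeff Z i = 0"
        using Suc.prems degree_zonal_poly_le[of ?D ?j] unfolding Z_def by (auto intro!: coeff_eq_0)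
      then show ?thesis by (simp add: g'_def)
    qed
  qed
  from Suc.IH[OF this] obtain f where f: "smooth_harmonic k f" "f 0 = 0"
    "\<And>x. x \<in> sphere 0 1 \<Longrightarrow> f x = poly (?L g') (x $ N)" by auto
  let ?l = "- (real ?j * (real ?j + ?D - 2))"
  have "?L g = ?L g' + smult c (?L Z)"
    by (simp add: g'_def pderiv_diff pderiv_smult wderiv_diff wderiv_smult)
  also have "?L Z = smult ?l Z"
    unfolding Z_def by (rule zonal_poly_eigen) (use assms(1) in simp)
  finally have Lg: "?L g = ?L g' + smult (c * ?l) Z" by simp
  have "solid_zonal N ?j 0 = 0"
    unfolding solid_zonal_def
  proof (intro sum.neutral ballI)
    fix i assume "i \<in> {..?j div 2}"
    have "?j - 2 * i \<noteq> 0 \<or> i \<noteq> 0" by auto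
    then have "((0::real^'n) $ N) ^ (?j - 2 * i) * (0 \<bullet> (0::real^'n)) ^ i = 0"
      by (auto simp: zero_power)
    then show "zonal_coeff ?D ?j i * (((0::real^'n) $ N) ^ (?j - 2 * i) * (0 \<bullet> (0::real^'n)) ^ i) = 0"
      by simp
  qed
  moreover have "smooth_harmonic ?j (\<lambda>x. f x + (c * ?l) * solid_zonal N ?j x)"
    by (rule smooth_harmonic_add_cmult[OF f(1) smooth_harmonic_solid_zonal[OF assms(1)]]) simp
  ultimately show ?case
    by (intro exI[of _ "\<lambda>x. f x + (c * ?l) * solid_zonal N ?j x"] conjI ballI)
      (simp_all add: f solid_zonal_sphere Lg Z_def[symmetric] del: of_nat_Suc)
qed

section \<open>Spherical caps\<close>

lemma sphere_point_with_component:
  assumes "CARD('n::finite) \<ge> 2" and "\<bar>t\<bar> \<le> 1"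
  shows "\<exists>x::real^'n. x \<in> sphere 0 1 \<and> x $ (N::'n) = t"
proof -
  have "\<exists>M. M \<noteq> N"
  proof (rule ccontr)
    assume "\<not> ?thesis"
    then have "(UNIV :: 'n set) = {N}" by auto
    then have "CARD('n) = 1" by (metis card.empty card_insert_disjoint empty_iff finite.emptyI One_nat_def)
    with assms show False by simp
  qed
  then obtain M where M: "M \<noteq> N" by blast
  define x where "x = t *\<^sub>R axis N 1 + sqrt (1 - t\<^sup>2) *\<^sub>R (axis M 1 :: real^'n)"
  have t: "t\<^sup>2 \<le> 1" using assms(2) by (simp add: abs_square_le_1)
  have "x \<bullet> x = t\<^sup>2 + (sqrt (1 - t\<^sup>2))\<^sup>2"
    using M by (simp add: x_def inner_add_left inner_add_right inner_axis_axis power2_eq_square)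
  with t have "x \<bullet> x = 1" by simp
  moreover have "x $ N = t" using M by (simp add: x_def axis_def)
  ultimately show ?thesis by (intro exI[of _ x]) (simp add: norm_eq_1)
qed

text \<open>
  The bridge from polynomials in one variable to \<^const>\<open>tau\<close>: the hypothesis that \<open>p\<close> lies in the range
  of \<open>wderiv\<close> plays the role of the mean value \<open>0\<close>, which is what makes the extension vanish at \<open>0\<close>.
\<close>

lemma tau_le_measure_cap:
  fixes p h :: "real poly"
  assumes card: "CARD('n::{finite,linorder}) \<ge> 2"
    and p: "p = wderiv ((real CARD('n) - 1) / 2) ((real CARD('n) - 1) / 2) h"
    and "p \<noteq> 0" and "degree p \<le> k"
    and pos: "\<And>t. \<bar>t\<bar> \<le> 1 \<Longrightarrow> poly p t > 0 \<Longrightarrow> s \<le> t"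
  shows "tau TYPE('n) k \<le> measure sphere_measure (cap s :: (real^'n::_) set)"
proof -
  let ?a = "(real CARD('n) - 1) / 2" and ?N = "Max UNIV :: 'n"
  have "h \<noteq> 0" using \<open>p \<noteq> 0\<close> p by (auto simp: wderiv_def)
  have "degree h < k"
  proof (rule ccontr)
    assume "\<not> degree h < k"
    then have "coeff p (Suc (degree h)) = 0"
      using \<open>degree p \<le> k\<close> by (intro coeff_eq_0) auto
    then have "(?a + ?a + real (degree h)) * lead_coeff h = 0"
      using coeff_wderiv_top[of h "degree h" ?a ?a] p by (simp add: algebra_simps)
    moreover have "?a + ?a + real (degree h) > 0" using card by simp
    ultimately show False using \<open>h \<noteq> 0\<close> by auto
  qed
  obtain g where g: "pderiv g = h" "degree g \<le> k"
  proof
    let ?g = "\<Sum>i\<le>degree h. monom (coeff h i / real (Suc i)) (Suc i)"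
    have pd: "pderiv (\<Sum>i\<in>I. q i) = (\<Sum>i\<in>I. pderiv (q i))" for q :: "nat \<Rightarrow> real poly" and I
      by (induction I rule: infinite_finite_induct) (simp_all add: pderiv_add)
    show "pderiv ?g = h"
      unfolding pd by (subst (3) poly_as_sum_of_monoms[of h, symmetric])
        (simp add: pderiv_monom del: of_nat_Suc)
    show "degree ?g \<le> k"
      using \<open>degree h < k\<close>
      by (intro degree_sum_le) (auto intro: order.trans[OF degree_monom_le])
  qed
  from zonal_harmonic_extension[OF card g(2), of ?N] g(1) p
  obtain f where f: "smooth_harmonic k f" "f 0 = 0" "\<And>x. x \<in> sphere 0 1 \<Longrightarrow> f x = poly p (x $ ?N)"
    by auto
  have "finite {t. poly p t = 0}" using \<open>p \<noteq> 0\<close> by (rule poly_roots_finite)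
  moreover have "infinite {-1..1::real}" by (simp add: infinite_Icc)
  ultimately have "\<not> {-1..1} \<subseteq> {t. poly p t = 0}" by (meson finite_subset)
  then obtain t where t: "\<bar>t\<bar> \<le> 1" "poly p t \<noteq> 0" by force
  then obtain x :: "real^'n::_" where "x \<in> sphere 0 1" "x $ ?N = t"
    using sphere_point_with_component[OF card] by blast
  with f(3) t have "f x \<noteq> 0" by simp
  then have nz: "f \<noteq> (\<lambda>_. 0)" by auto
  interpret prob_space "sphere_measure :: (real^'n::_) measure" by (rule prob_space_sphere_measure)
  have "tau TYPE('n) k \<le> measure sphere_measure {x \<in> sphere 0 1. f x > 0}"
    unfolding tau_def
  proof (rule cInf_lower)
    show "measure sphere_measure {x \<in> sphere 0 1. f x > 0} \<in>
        {measure sphere_measure {x \<in> sphere 0 1. f x > 0} | f :: real^'n::_ \<Rightarrow> real.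
            harmonic_poly k f \<and> f \<noteq> (\<lambda>_. 0) \<and> f 0 = 0}"
      using nz f smooth_harmonic_imp_harmonic_poly by blast
    show "bdd_below {measure sphere_measure {x \<in> sphere 0 1. f x > 0} | f :: real^'n::_ \<Rightarrow> real.
            harmonic_poly k f \<and> f \<noteq> (\<lambda>_. 0) \<and> f 0 = 0}"
      by (rule bdd_belowI[of _ 0]) auto
  qed
  also have "\<dots> \<le> measure sphere_measure (cap s :: (real^'n::_) set)"
  proof (rule finite_measure_mono)
    show "{x \<in> sphere 0 1. f x > 0} \<subseteq> cap s"
    proof
      fix x assume x: "x \<in> {x \<in> sphere 0 1. f x > 0}"
      then have "\<bar>x $ ?N\<bar> \<le> 1" using component_le_norm_cart[of x ?N] by simp
      with x pos[of "x $ ?N"] f(3) show "x \<in> cap s"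
        by (auto simp: cap_def north_pole_def inner_axis)
    qed
    have "closed (cap s :: (real^'n::_) set)"
      unfolding cap_def Collect_conj_eq Collect_mem_eq
      by (intro closed_Int closed_sphere closed_Collect_le continuous_intros)
    then show "(cap s :: (real^'n::_) set) \<in> sets sphere_measure"
      by (auto simp: sets_sphere_measure_iff cap_def)
  qed
  finally show ?thesis .
qed

text \<open>
  The largest zero is a genuine one: it is the maximum of a set that is nonempty by Rolle's theorem
  and finite since the polynomial is nonzero.
\<close>

lemma jacobi_poly_split_at_largest_zero:
  assumes "n \<ge> 1" "a > -1" "b > -1"
  obtains q where "rodrigues_poly n a b = [:- largest_zero (jacobi_poly n a b), 1:] * q"
    and "rodrigues_poly n a b * q \<noteq> 0" and "degree q < n"
proof -
  let ?R = "rodrigues_poly n a b" and ?z = "largest_zero (jacobi_poly n a b)"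
  have nz: "?R \<noteq> 0" using assms by (simp add: rodrigues_poly_nonzero)
  have eq: "{x. poly (jacobi_poly n a b) x = 0} = {x. poly ?R x = 0}"
    by (simp add: jacobi_poly_eq)
  have "?z \<in> {x. poly ?R x = 0}"
    unfolding largest_zero_def eq
    using poly_roots_finite[OF nz] rodrigues_poly_has_root[OF assms] by (intro Max_in) auto
  then obtain q where q: "?R = [:- ?z, 1:] * q"
    by (auto simp: poly_eq_0_iff_dvd elim: dvdE)
  with nz have "q \<noteq> 0" by auto
  moreover have "degree q < n"
  proof -
    have "degree ?R = 1 + degree q"
      unfolding q using \<open>q \<noteq> 0\<close> by (subst degree_mult_eq) auto
    then show ?thesis using degree_rodrigues_poly_le[of n a b] by simp
  qed
  ultimately show ?thesis using that q nz by simp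
qed

theorem corollary5:
  fixes d n :: nat and \<alpha> :: real
  assumes "d \<ge> 2" and "n \<ge> 1"
    and "CARD('n::{finite,linorder}) = d + 1"
    and "\<alpha> = (real d - 2) / 2"
  shows "tau TYPE('n) (2 * n - 1) \<le>
           measure sphere_measure (cap (largest_zero (jacobi_poly n \<alpha> \<alpha>)) :: (real^'n::_) set)
       \<and> tau TYPE('n) (2 * n) \<le>
           measure sphere_measure (cap (largest_zero (jacobi_poly n \<alpha> (\<alpha> + 1))) :: (real^'n::_) set)"
proof
  have card: "CARD('n) \<ge> 2" and a: "\<alpha> > -1"
    and w: "(real CARD('n) - 1) / 2 = \<alpha> + 1"
    using assms by (auto simp: field_simps)
  show "tau TYPE('n) (2 * n - 1) \<le>
          measure sphere_measure (cap (largest_zero (jacobi_poly n \<alpha> \<alpha>)) :: (real^'n::_) set)"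
  proof -
    let ?R = "rodrigues_poly n \<alpha> \<alpha>" and ?z = "largest_zero (jacobi_poly n \<alpha> \<alpha>)"
    obtain q where q: "?R = [:- ?z, 1:] * q" "?R * q \<noteq> 0" "degree q < n"
      using jacobi_poly_split_at_largest_zero[OF assms(2) a a] .
    obtain h where h: "?R * q = wderiv (\<alpha> + 1) (\<alpha> + 1) h"
      using rodrigues_poly_mult_in_range[OF q(3)] by blast
    show ?thesis
    proof (rule tau_le_measure_cap[OF card, unfolded w, OF h])
      show "?R * q \<noteq> 0" by (rule q(2))
      show "degree (?R * q) \<le> 2 * n - 1"
        using degree_mult_le[of ?R q] degree_rodrigues_poly_le[of n \<alpha> \<alpha>] q(3) by simp
      show "?z \<le> t" if "poly (?R * q) t > 0" for t
      proof -
        have "poly (?R * q) t = (t - ?z) * (poly q t)\<^sup>2"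
          unfolding q(1) by (simp add: power2_eq_square algebra_simps)
        with that have "(t - ?z) * (poly q t)\<^sup>2 > 0" by (simp only:)
        then show ?thesis by (simp add: zero_less_mult_iff)
      qed
    qed
  qed
  show "tau TYPE('n) (2 * n) \<le>
          measure sphere_measure (cap (largest_zero (jacobi_poly n \<alpha> (\<alpha> + 1))) :: (real^'n::_) set)"
  proof -
    let ?R = "rodrigues_poly n \<alpha> (\<alpha> + 1)" and ?z = "largest_zero (jacobi_poly n \<alpha> (\<alpha> + 1))"
    have a': "\<alpha> + 1 > -1" using a by simp
    obtain q where q: "?R = [:- ?z, 1:] * q" "?R * q \<noteq> 0" "degree q < n"
      using jacobi_poly_split_at_largest_zero[OF assms(2) a a'] .
    obtain h where "?R * q = wderiv (\<alpha> + 1) (\<alpha> + 1 + 1) h"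
      using rodrigues_poly_mult_in_range[OF q(3)] by blast
    then have h: "[:1, 1:] * (?R * q) = wderiv (\<alpha> + 1) (\<alpha> + 1) ([:1, 1:] * h)"
      unfolding wderiv_shift_right by simp
    show ?thesis
    proof (rule tau_le_measure_cap[OF card, unfolded w, OF h])
      show "[:1, 1:] * (?R * q) \<noteq> 0" using q(2) by (simp del: mult_pCons_left)
      show "degree ([:1, 1:] * (?R * q)) \<le> 2 * n"
        using degree_mult_le[of "[:1, 1:]" "?R * q"] degree_mult_le[of ?R q]
          degree_rodrigues_poly_le[of n \<alpha> "\<alpha> + 1"] q(3) by (simp del: mult_pCons_left)
      show "?z \<le> t" if "\<bar>t\<bar> \<le> 1" "poly ([:1, 1:] * (?R * q)) t > 0" for t
      proof -
        have "poly ([:1, 1:] * (?R * q)) t = (t - ?z) * ((1 + t) * (poly q t)\<^sup>2)"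
          unfolding q(1) by (simp add: power2_eq_square algebra_simps)
        with that(2) have "(t - ?z) * ((1 + t) * (poly q t)\<^sup>2) > 0" by (simp only:)
        moreover have "(1 + t) * (poly q t)\<^sup>2 \<ge> 0" using that(1) by simp
        ultimately show ?thesis by (simp add: zero_less_mult_iff[of "t - ?z"])
      qed
    qed
  qed
qed

end
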